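(* Let $\mathbb{G}_U$ be a (finite) group of unitary operators on $\mathbb{C}^D$, let $U$ be a unitary operator on $\mathbb{C}^D$, and let $\Gamma(U)$ be a noisy encoded gadget implementing $U$, i.e. a quantum channel on the operators on $\mathbb{C}^D$. For $G\in\mathbb{G}_U$, apply the ideal operation $G$ before the gadget $\Gamma(U)$ and the ideal operation $UG^\dagger U^\dagger$ after it. Averaging uniformly over $G\in\mathbb{G}_U$ produces an effective channel $$\frac{1}{|\mathbb{G}_U|}\sum_{G\in\mathbb{G}_U}\mathcal{A}(UG^\dagger U^\dagger)\,\Gamma(U)\,\mathcal{A}(G)$$ which is comprised of the ideal action of $U$ followed by the noise introduced by $\Gamma(U)$ twirled over $\mathbb{G}_U$.
   Context: For an operator $M$ on $\mathbb{C}^D$, $\mathcal{A}(M)$ denotes the linear map $\rho\mapsto M\rho M^\dagger$ on operators on $\mathbb{C}^D$; the ideal action of $U$ is $\mathcal{A}(U)$. Juxtaposition of maps is composition, with the rightmost map applied first. The noise introduced by $\Gamma(U)$ is the map $\Delta_U=\mathcal{A}(U^\dagger)\,\Gamma(U)$, so that $\Gamma(U)=\mathcal{A}(U)\Delta_U$. For a finite group $\mathbb{G}$ of unitary operators on $\mathbb{C}^D$ and a channel (linear map) $\Lambda$ on operators on $\mathbb{C}^D$, the twirl of $\Lambda$ over $\mathbb{G}$ is $$\Lambda^{\circlearrowright\mathbb{G}}=\frac{1}{|\mathbb{G}|}\sum_{G\in\mathbb{G}}\mathcal{A}(G^\dagger)\,\Lambda\,\mathcal{A}(G).$$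
   Formalization: The effective channel is proved to be 𝒜(U) composed with the twirled noise, noise acting first, as in Γ(U)=𝒜(U)Δ_U; "the ideal action of U followed by the noise", read in time order with Δ_U=𝒜(U†)Γ(U), fails in general. *)

theory Defs
  imports "HOL-Analysis.Analysis" "HOL-Algebra.Group"
begin

text \<open>Operators on \<open>\<complex>\<^sup>D\<close> are square matrices indexed by a finite type, with \<open>D = CARD('d)\<close>;
  superoperators are functions between them.\<close>

type_synonym 'd operator = "complex^'d^'d"
type_synonym 'd superop = "'d operator \<Rightarrow> 'd operator"

definition adj :: "'d::finite operator \<Rightarrow> 'd operator" where
  "adj M = (\<chi> i j. cnj (M $ j $ i))"

definition unitary :: "'d::finite operator \<Rightarrow> bool" where
  "unitary U \<longleftrightarrow> adj U ** U = mat 1 \<and> U ** adj U = mat 1"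

definition unitary_group :: "'d::finite operator monoid" where
  "unitary_group = \<lparr>carrier = {U. unitary U}, mult = (**), one = mat 1\<rparr>"

definition cscale :: "complex \<Rightarrow> 'd::finite operator \<Rightarrow> 'd operator" where
  "cscale c M = (\<chi> i j. c * M $ i $ j)"

text \<open>A family \<open>X i j\<close> with \<open>i, j < k\<close> is read as the \<open>k \<times> k\<close> block matrix of an operator on
  \<open>\<complex>\<^sup>k \<otimes> \<complex>\<^sup>D\<close>, and \<open>v i\<close> with \<open>i < k\<close> as a vector of that space. Applying a map blockwise is
  the action of \<open>id\<^sub>k \<otimes> \<Lambda>\<close>. Over the complex numbers, nonnegativity of the quadratic form
  includes hermiticity.\<close>

definition pos_semidef_block :: "nat \<Rightarrow> (nat \<Rightarrow> nat \<Rightarrow> 'd::finite operator) \<Rightarrow> bool" where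
  "pos_semidef_block k X \<longleftrightarrow>
     (\<forall>v :: nat \<Rightarrow> complex^'d.
        (\<Sum>i<k. \<Sum>j<k. \<Sum>a\<in>UNIV. cnj (v i $ a) * (X i j *v v j) $ a) \<in> \<real>\<^sub>\<ge>\<^sub>0)"

definition completely_positive :: "'d::finite superop \<Rightarrow> bool" where
  "completely_positive \<Lambda> \<longleftrightarrow>
     (\<forall>k X. pos_semidef_block k X \<longrightarrow> pos_semidef_block k (\<lambda>i j. \<Lambda> (X i j)))"

definition trace_preserving :: "'d::finite superop \<Rightarrow> bool" where
  "trace_preserving \<Lambda> \<longleftrightarrow> (\<forall>\<rho>. trace (\<Lambda> \<rho>) = trace \<rho>)"

definition quantum_channel :: "'d::finite superop \<Rightarrow> bool" where
  "quantum_channel \<Lambda> \<longleftrightarrow>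
     Vector_Spaces.linear cscale cscale \<Lambda> \<and> completely_positive \<Lambda> \<and> trace_preserving \<Lambda>"

definition conj_action :: "'d::finite operator \<Rightarrow> 'd superop" ("\<A>") where
  "\<A> M = (\<lambda>\<rho>. M ** \<rho> ** adj M)"

definition average :: "'d::finite operator set \<Rightarrow> ('d operator \<Rightarrow> 'd superop) \<Rightarrow> 'd superop" where
  "average \<G> F = (\<lambda>\<rho>. (1 / real (card \<G>)) *\<^sub>R (\<Sum>G\<in>\<G>. F G \<rho>))"

definition twirl :: "'d::finite operator set \<Rightarrow> 'd superop \<Rightarrow> 'd superop" where
  "twirl \<G> \<Lambda> = average \<G> (\<lambda>G. \<A> (adj G) \<circ> \<Lambda> \<circ> \<A> G)"

text \<open>A gadget assignment \<open>\<Gamma>\<close> sends an ideal operator to its noisy implementation.\<close>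

definition noise :: "('d::finite operator \<Rightarrow> 'd superop) \<Rightarrow> 'd operator \<Rightarrow> 'd superop" where
  "noise \<Gamma> U = \<A> (adj U) \<circ> \<Gamma> U"

lemma adj_adj [simp]: "adj (adj M) = M"
  by (simp add: adj_def vec_eq_iff)

lemma adj_mat_1 [simp]: "adj (mat 1) = mat 1"
  by (auto simp: adj_def mat_def vec_eq_iff)

lemma adj_mult: "adj (M ** N) = adj N ** adj M"
  by (simp add: adj_def matrix_matrix_mult_def vec_eq_iff mult.commute)

lemma vector_space_cscale: "vector_space (cscale :: complex \<Rightarrow> 'd::finite operator \<Rightarrow> 'd operator)"
  by unfold_locales (simp_all add: cscale_def vec_eq_iff algebra_simps)

lemma unitary_mult: "unitary U \<Longrightarrow> unitary V \<Longrightarrow> unitary (U ** V)"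
  unfolding unitary_def adj_mult by (metis matrix_mul_assoc matrix_mul_rid)

lemma unitary_adj: "unitary U \<Longrightarrow> unitary (adj U)"
  by (simp add: unitary_def)

lemma group_unitary_group: "group (unitary_group :: 'd::finite operator monoid)"
proof (rule groupI)
  fix U :: "'d operator"
  assume "U \<in> carrier unitary_group"
  then show "\<exists>V\<in>carrier unitary_group. V \<otimes>\<^bsub>unitary_group\<^esub> U = \<one>\<^bsub>unitary_group\<^esub>"
    using unitary_adj[of U]
    by (intro bexI[of _ "adj U"]) (simp_all add: unitary_group_def, simp add: unitary_def)
qed (auto simp: unitary_group_def unitary_mult matrix_mul_assoc, simp add: unitary_def)

lemma inv_unitary_group: "unitary U \<Longrightarrow> inv\<^bsub>unitary_group\<^esub> U = adj U"
  by (rule group.inv_equality[OF group_unitary_group])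
    (use unitary_adj in \<open>auto simp: unitary_group_def unitary_def\<close>)

lemma gadget_eq_action_noise: "unitary U \<Longrightarrow> \<Gamma> U = \<A> U \<circ> noise \<Gamma> U"
  unfolding unitary_def noise_def conj_action_def fun_eq_iff
  by (simp add: matrix_mul_assoc) (metis matrix_mul_assoc matrix_mul_lid matrix_mul_rid)

end

theory Submission
  imports Defs
begin

text \<open>Conjugation is multiplicative in the operator (\<open>conj_action_mult\<close>), so the
  correction after the gadget splits as \<A>(U) \<A>(G^dagger) \<A>(U^dagger). Its last factor meets
  the gadget and forms the noise \<A>(U^dagger) \<Gamma>(U), while \<A>(U) does not depend on G and,
  being linear, comes out of the average (\<open>linear_comp_average\<close>). What remains inside
  is the twirl of the noise. That the average is a channel is a closure argument: conjugation by a
  unitary is a channel (\<open>quantum_channel_conj_action\<close>), and channels are closed under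
  composition and under uniform averages over finite nonempty sets
  (\<open>quantum_channel_comp\<close>, \<open>quantum_channel_average\<close>).\<close>

lemma cscale_matrix_mult_left: "cscale c M ** N = cscale c (M ** N)"
  by (simp add: cscale_def matrix_matrix_mult_def vec_eq_iff sum_distrib_left mult.assoc)

lemma cscale_matrix_mult_right: "M ** cscale c N = cscale c (M ** N)"
  by (simp add: cscale_def matrix_matrix_mult_def vec_eq_iff sum_distrib_left mult.left_commute)

lemma matrix_add_rdistrib: "(M + N) ** P = M ** P + N ** (P :: 'd::finite operator)"
  by (simp add: matrix_matrix_mult_def vec_eq_iff distrib_right sum.distrib)

text \<open>Bridges the real weight in \<open>average\<close> and the complex scaling for which maps
  are linear.\<close>

lemma scaleR_eq_cscale: "r *\<^sub>R M = cscale (complex_of_real r) M"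
  by (simp add: cscale_def vec_eq_iff) (simp add: scaleR_conv_of_real)

lemma linear_cscale_iff:
  "Vector_Spaces.linear cscale cscale \<Lambda> \<longleftrightarrow>
     (\<forall>M N. \<Lambda> (M + N) = \<Lambda> M + \<Lambda> N) \<and> (\<forall>c M. \<Lambda> (cscale c M) = cscale c (\<Lambda> M))"
  by (simp add: Vector_Spaces.linear_iff vector_space_cscale)

lemma linear_cscale_sum:
  assumes "Vector_Spaces.linear cscale cscale \<Lambda>"
  shows "\<Lambda> (\<Sum>x\<in>S. f x) = (\<Sum>x\<in>S. \<Lambda> (f x))"
proof -
  interpret Vector_Spaces.linear cscale cscale \<Lambda> by fact
  show ?thesis by (rule sum)
qed

lemma linear_comp_average:
  assumes "Vector_Spaces.linear cscale cscale \<Lambda>"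
  shows "\<Lambda> \<circ> average S F = average S (\<lambda>G. \<Lambda> \<circ> F G)"
  using assms
  by (simp add: average_def fun_eq_iff scaleR_eq_cscale linear_cscale_sum[OF assms, symmetric]
      linear_cscale_iff)

lemma conj_action_mult: "\<A> (M ** N) = \<A> M \<circ> \<A> N"
  by (simp add: conj_action_def fun_eq_iff adj_mult matrix_mul_assoc)

lemma linear_conj_action: "Vector_Spaces.linear cscale cscale (\<A> M)"
  by (simp add: linear_cscale_iff conj_action_def cscale_matrix_mult_left cscale_matrix_mult_right
      matrix_add_ldistrib matrix_add_rdistrib)

text \<open>The adjoint identity of the standard inner product, in the coordinates used by
  \<open>pos_semidef_block\<close>.\<close>

lemma adj_sesquilinear:
  "(\<Sum>a\<in>UNIV. cnj (v $ a) * (M *v w) $ a) = (\<Sum>a\<in>UNIV. cnj ((adj M *v v) $ a) * w $ a)"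
proof -
  have "(\<Sum>a\<in>UNIV. cnj (v $ a) * (M *v w) $ a)
      = (\<Sum>a\<in>UNIV. \<Sum>b\<in>UNIV. cnj (v $ a) * (M $ a $ b * w $ b))"
    by (simp add: matrix_vector_mult_def sum_distrib_left)
  also have "\<dots> = (\<Sum>b\<in>UNIV. \<Sum>a\<in>UNIV. cnj (v $ a) * (M $ a $ b * w $ b))"
    by (rule sum.swap)
  also have "\<dots> = (\<Sum>b\<in>UNIV. cnj ((adj M *v v) $ b) * w $ b)"
    by (simp add: matrix_vector_mult_def adj_def sum_distrib_left sum_distrib_right mult_ac)
  finally show ?thesis .
qed

text \<open>Conjugating every block by M amounts to replacing each test vector by its image under
  the adjoint of M, so the new quadratic form takes only values of the old one. M is arbitrary
  here.\<close>

lemma completely_positive_conj_action: "completely_positive (\<A> M)"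
  unfolding completely_positive_def
proof (intro allI impI)
  fix k and X :: "nat \<Rightarrow> nat \<Rightarrow> 'a operator"
  assume X: "pos_semidef_block k X"
  show "pos_semidef_block k (\<lambda>i j. \<A> M (X i j))"
    unfolding pos_semidef_block_def
  proof
    fix v :: "nat \<Rightarrow> complex^'a"
    have "(\<Sum>a\<in>UNIV. cnj (v i $ a) * (\<A> M (X i j) *v v j) $ a)
        = (\<Sum>a\<in>UNIV. cnj ((adj M *v v i) $ a) * (X i j *v (adj M *v v j)) $ a)" for i j
      unfolding conj_action_def
      \<comment> \<open>Moving M from the left test vector back onto the right one leaves only
        associativity.\<close>
      by (subst adj_sesquilinear[symmetric]) (simp add: matrix_vector_mul_assoc matrix_mul_assoc)
    then show "(\<Sum>i<k. \<Sum>j<k. \<Sum>a\<in>UNIV. cnj (v i $ a) * (\<A> M (X i j) *v v j) $ a) \<in> \<real>\<^sub>\<ge>\<^sub>0"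
      using X[unfolded pos_semidef_block_def, rule_format, of "\<lambda>i. adj M *v v i"] by simp
  qed
qed

text \<open>With the next three lemmas: positive semidefinite blocks form a convex cone, because the
  quadratic form is linear in the block matrix. Hence averages of completely positive maps stay
  completely positive.\<close>

lemma pos_semidef_block_zero: "pos_semidef_block k (\<lambda>i j. 0)"
  by (simp add: pos_semidef_block_def)

lemma pos_semidef_block_add:
  assumes "pos_semidef_block k X" and "pos_semidef_block k Y"
  shows "pos_semidef_block k (\<lambda>i j. X i j + Y i j)"
  using assms unfolding pos_semidef_block_def
  by (simp add: matrix_vector_mult_add_rdistrib distrib_left sum.distrib nonneg_Reals_add_I)

lemma pos_semidef_block_scaleR:
  assumes "pos_semidef_block k X" and "0 \<le> r"
  shows "pos_semidef_block k (\<lambda>i j. r *\<^sub>R X i j)"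
proof -
  have "cnj (v i $ a) * ((r *\<^sub>R X i j) *v v j) $ a
      = of_real r * (cnj (v i $ a) * (X i j *v v j) $ a)" for v :: "nat \<Rightarrow> complex^'a" and i j a
    by (simp add: scaleR_eq_cscale cscale_def matrix_vector_mult_def sum_distrib_left mult_ac)
  with assms show ?thesis
    unfolding pos_semidef_block_def
    by (simp only: sum_distrib_left[symmetric]) (simp add: nonneg_Reals_mult_I)
qed

lemma pos_semidef_block_sum:
  assumes "finite S" and "\<And>x. x \<in> S \<Longrightarrow> pos_semidef_block k (X x)"
  shows "pos_semidef_block k (\<lambda>i j. \<Sum>x\<in>S. X x i j)"
  using assms by (induction S) (simp_all add: pos_semidef_block_zero pos_semidef_block_add)

lemma trace_scaleR: "trace (r *\<^sub>R M) = r *\<^sub>R trace (M :: 'd::finite operator)"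
  by (simp add: trace_def scaleR_sum_right)

lemma trace_sum:
  "finite S \<Longrightarrow> trace (\<Sum>x\<in>S. f x) = (\<Sum>x\<in>S. trace (f x :: 'd::finite operator))"
  by (induction S rule: finite_induct) (simp_all add: trace_add trace_0[unfolded mat_0])

lemma quantum_channel_conj_action:
  assumes "unitary V"
  shows "quantum_channel (\<A> V)"
proof -
  have "trace (\<A> V \<rho>) = trace \<rho>" for \<rho>
    \<comment> \<open>Cyclicity of the trace brings the adjoint of V next to V, where the two
      cancel.\<close>
    using assms unfolding conj_action_def unitary_def
    by (subst trace_mul_sym) (simp add: matrix_mul_assoc)
  then show ?thesis
    by (simp add: quantum_channel_def trace_preserving_def linear_conj_action
        completely_positive_conj_action)
qed

lemma quantum_channel_comp:
  "quantum_channel \<Lambda> \<Longrightarrow> quantum_channel \<Phi> \<Longrightarrow> quantum_channel (\<Lambda> \<circ> \<Phi>)"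
  by (simp add: quantum_channel_def linear_cscale_iff completely_positive_def trace_preserving_def)

text \<open>Nonemptiness makes the weights sum to 1, as trace preservation demands; the empty
  average would be the zero map.\<close>

lemma quantum_channel_average:
  assumes "finite S" and "S \<noteq> {}" and F: "\<And>G. G \<in> S \<Longrightarrow> quantum_channel (F G)"
  shows "quantum_channel (average S F)"
  unfolding quantum_channel_def
proof (intro conjI)
  interpret vector_space "cscale :: complex \<Rightarrow> 'a operator \<Rightarrow> 'a operator"
    by (rule vector_space_cscale)
  show "Vector_Spaces.linear cscale cscale (average S F)"
    using F by (auto simp: linear_cscale_iff average_def quantum_channel_def scaleR_eq_cscale
        sum.distrib scale_right_distrib scale_sum_right mult.commute)
  show "completely_positive (average S F)"
    using assms unfolding completely_positive_def average_def quantum_channel_def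
    by (auto intro!: pos_semidef_block_scaleR pos_semidef_block_sum)
  show "trace_preserving (average S F)"
    using assms by (simp add: trace_preserving_def average_def quantum_channel_def
        trace_scaleR trace_sum) (simp add: scaleR_conv_of_real)
qed

theorem theorem2:
  fixes \<G> :: "'d::finite operator set"
    and U :: "'d operator"
    and \<Gamma> :: "'d operator \<Rightarrow> 'd superop"
  assumes "finite \<G>"
    and "subgroup \<G> unitary_group"
    and "unitary U"
    and "quantum_channel (\<Gamma> U)"
  shows "quantum_channel (average \<G> (\<lambda>G. \<A> (U ** adj G ** adj U) \<circ> \<Gamma> U \<circ> \<A> G)) \<and>
    average \<G> (\<lambda>G. \<A> (U ** adj G ** adj U) \<circ> \<Gamma> U \<circ> \<A> G) = \<A> U \<circ> twirl \<G> (noise \<Gamma> U)"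
proof
  have "unitary G" if "G \<in> \<G>" for G
    using subgroup.subset[OF assms(2)] that by (auto simp: unitary_group_def)
  \<comment> \<open>A subgroup contains the identity, so the average is a genuine convex
    combination.\<close>
  moreover have "\<G> \<noteq> {}"
    using subgroup.one_closed[OF assms(2)] by blast
  ultimately show "quantum_channel (average \<G> (\<lambda>G. \<A> (U ** adj G ** adj U) \<circ> \<Gamma> U \<circ> \<A> G))"
    using assms by (intro quantum_channel_average quantum_channel_comp quantum_channel_conj_action
        unitary_mult unitary_adj) auto
  show "average \<G> (\<lambda>G. \<A> (U ** adj G ** adj U) \<circ> \<Gamma> U \<circ> \<A> G) = \<A> U \<circ> twirl \<G> (noise \<Gamma> U)"
    by (simp add: twirl_def noise_def linear_comp_average[OF linear_conj_action]
        conj_action_mult o_assoc)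
qed

end
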